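(* Let $\mathcal{G}$ be a finite simple graph embedded in the complex plane, let $x=(x_e)_{e\in E(\mathcal{G})}$ be a system of nonzero complex weights on its undirected edges, and let $\vec{x}=(\vec{x}_{\vec{e}})_{\vec{e}\in\vec{E}(\mathcal{G})}$ be a system of nonzero complex weights on its directed edges. If $x$ factorizes to $\vec{x}$, i.e. $x_e=\vec{x}_{\vec{e}}\,\vec{x}_{-\vec{e}}$ for all $\vec{e}\in\vec{E}(\mathcal{G})$, then the spectral radius of the transition matrix $\Lambda(x)$ satisfies $$\rho(\Lambda(x))\le\max_{z\in V(\mathcal{G})}\xi^z(\vec{x}).$$
   Context: $V(\mathcal{G})$ is the set of vertices of $\mathcal{G}$, identified with the corresponding complex numbers. $E(\mathcal{G})$ is the set of undirected edges and $\vec{E}(\mathcal{G})$ the set of directed edges: ordered pairs $\vec{e}=(z,w)$ with $e=\{z,w\}\in E(\mathcal{G})$; the tail is $t(\vec{e})=z$, the head $h(\vec{e})=w$, the reversal $-\vec{e}=(w,z)$. $\mathrm{Out}_{\mathcal{G}}(z)=\{\vec{e}\in\vec{E}(\mathcal{G}):t(\vec{e})=z\}$. The turning angle is $\angle(\vec{e},\vec{g})=\mathrm{Arg}\Big(\frac{h(\vec{g})-t(\vec{g})}{h(\vec{e})-t(\vec{e})}\Big)\in(-\pi,\pi]$. The (Kac–Ward) transition matrix $\Lambda(x)$, indexed by $\vec{E}(\mathcal{G})\times\vec{E}(\mathcal{G})$, has entries $$\Lambda_{\vec{e},\vec{g}}(x)=\begin{cases}x_e\,e^{\frac{i}{2}\angle(\vec{e},\vec{g})}&\text{if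 }h(\vec{e})=t(\vec{g})\text{ and }\vec{g}\neq-\vec{e},\\0&\text{otherwise.}\end{cases}$$ For $z\in V(\mathcal{G})$, $\xi^z(\vec{x})$ is defined to be the unique solution in $s$ of the equation $\sum_{\vec{e}\in\mathrm{Out}_{\mathcal{G}}(z)}\arctan\big(|\vec{x}_{\vec{e}}|^2/s\big)=\frac{\pi}{2}$. *)

theory Defs
  imports "HOL-Analysis.Analysis" "Jordan_Normal_Form.Spectral_Radius"
begin

text \<open>
  Vertices are complex numbers, undirected edges are two-element sets of vertices, and edges are
  drawn as straight segments (the turning angle depends only on the end points).  The segment of
  an edge \<open>{z, w}\<close> is \<open>convex hull {z, w}\<close>.
  Distinct edges meet only in common end points, and an edge contains no further vertices.
\<close>

definition embedded_graph :: "complex set \<Rightarrow> complex set set \<Rightarrow> bool" where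
  "embedded_graph V E \<longleftrightarrow>
     finite V \<and>
     (\<forall>e\<in>E. \<exists>z\<in>V. \<exists>w\<in>V. z \<noteq> w \<and> e = {z, w}) \<and>
     (\<forall>e\<in>E. convex hull e \<inter> V = e) \<and>
     (\<forall>e\<in>E. \<forall>f\<in>E. e \<noteq> f \<longrightarrow> convex hull e \<inter> convex hull f = e \<inter> f)"

type_synonym dart = "complex \<times> complex"

abbreviation tail :: "dart \<Rightarrow> complex" where "tail \<equiv> fst"

abbreviation head :: "dart \<Rightarrow> complex" where "head \<equiv> snd"

abbreviation reversal :: "dart \<Rightarrow> dart" where "reversal \<equiv> prod.swap"

abbreviation undirected :: "dart \<Rightarrow> complex set" where "undirected d \<equiv> {tail d, head d}"

definition darts :: "complex set set \<Rightarrow> dart set" where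
  "darts E = {d. undirected d \<in> E}"

definition out_darts :: "complex set set \<Rightarrow> complex \<Rightarrow> dart set" where
  "out_darts E z = {d \<in> darts E. tail d = z}"

definition turning_angle :: "dart \<Rightarrow> dart \<Rightarrow> real" where
  "turning_angle d g = Arg ((head g - tail g) / (head d - tail d))"

definition transition_entry :: "(complex set \<Rightarrow> complex) \<Rightarrow> dart \<Rightarrow> dart \<Rightarrow> complex" where
  "transition_entry x d g =
     (if head d = tail g \<and> g \<noteq> reversal d
      then x (undirected d) * exp (\<i> / 2 * complex_of_real (turning_angle d g))
      else 0)"

text \<open>
  The library's matrices are indexed by natural numbers, so the directed edges are enumerated by a
  list \<open>ds\<close> (meant to be distinct with \<open>set ds = darts E\<close>).
\<close>

definition transition_matrix :: "dart list \<Rightarrow> (complex set \<Rightarrow> complex) \<Rightarrow> complex mat" where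
  "transition_matrix ds x =
     mat (length ds) (length ds) (\<lambda>(i, j). transition_entry x (ds ! i) (ds ! j))"

text \<open>
  \<^const>\<open>spectral_radius\<close> is a maximum over the spectrum, hence unspecified for the empty matrix,
  which occurs for a graph without edges.  Its spectral radius is taken to be 0.
\<close>

definition spec_rad :: "complex mat \<Rightarrow> real" where
  "spec_rad A = (if dim_row A = 0 then 0 else spectral_radius A)"

text \<open>
  The equation defining \<open>\<xi>\<close> has a real solution only if at least two directed edges leave \<open>z\<close>, and
  then exactly one (lemma \<open>xi_equation_ex1\<close> below).  For a single one, \<open>s = 0\<close> is the solution under
  the reading \<open>arctan (a / 0) = \<pi> / 2\<close> for \<open>a > 0\<close>.  For an isolated vertex, where there is no
  solution even then, the value is 0 as well, so that isolated vertices do not affect the maximum.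
\<close>

definition xi :: "complex set set \<Rightarrow> (dart \<Rightarrow> complex) \<Rightarrow> complex \<Rightarrow> real" where
  "xi E y z =
     (if card (out_darts E z) \<le> 1 then 0
      else (THE s. (\<Sum>d\<in>out_darts E z. arctan ((cmod (y d))\<^sup>2 / s)) = pi / 2))"

definition factorizes ::
    "complex set set \<Rightarrow> (complex set \<Rightarrow> complex) \<Rightarrow> (dart \<Rightarrow> complex) \<Rightarrow> bool" where
  "factorizes E x y \<longleftrightarrow> (\<forall>d\<in>darts E. x (undirected d) = y d * y (reversal d))"

lemma xi_equation_ex1:
  fixes a :: "'a \<Rightarrow> real"
  assumes card: "card D \<ge> 2" and pos: "\<And>d. d \<in> D \<Longrightarrow> a d > 0"
  shows "\<exists>!s. (\<Sum>d\<in>D. arctan (a d / s)) = pi / 2"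
proof -
  define F where "F s = (\<Sum>d\<in>D. arctan (a d / s))" for s :: real
  have fin: "finite D" using card by (metis card.infinite not_numeral_le_zero)
  have ne: "D \<noteq> {}" using card by auto
  have le0: "F s \<le> 0" if "s \<le> 0" for s
    unfolding F_def
  proof (rule sum_nonpos)
    fix d assume "d \<in> D"
    then have "a d / s \<le> 0" using pos[of d] that by (auto simp: divide_le_0_iff)
    then show "arctan (a d / s) \<le> 0" by simp
  qed
  have dec: "F t < F s" if "0 < s" "s < t" for s t
    unfolding F_def
  proof (rule sum_strict_mono[OF fin ne])
    fix d assume "d \<in> D"
    then show "arctan (a d / t) < arctan (a d / s)"
      using pos[of d] that by (auto intro!: arctan_monotone divide_strict_left_mono)
  qed
  have lim0: "(F \<longlongrightarrow> (\<Sum>d\<in>D. pi / 2)) (at_right 0)"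
    unfolding F_def
  proof (rule tendsto_sum)
    fix d assume d: "d \<in> D"
    have "filterlim (\<lambda>s. a d / s) at_top (at_right 0)"
      using filterlim_tendsto_pos_mult_at_top[OF tendsto_const pos[OF d] filterlim_inverse_at_top_right]
      by (simp add: divide_inverse)
    then show "((\<lambda>s. arctan (a d / s)) \<longlongrightarrow> pi / 2) (at_right 0)"
      by (rule filterlim_compose[OF tendsto_arctan_at_top])
  qed
  have liminf: "(F \<longlongrightarrow> 0) at_top"
  proof -
    have "(F \<longlongrightarrow> (\<Sum>d\<in>D. arctan 0)) at_top"
      unfolding F_def
      by (intro tendsto_sum tendsto_arctan tendsto_divide_0[OF tendsto_const]
          filterlim_at_top_imp_at_infinity filterlim_ident)
    then show ?thesis by simp
  qed
  have "(\<Sum>d\<in>D. pi / 2) = real (card D) * (pi / 2)" by simp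
  also have "\<dots> \<ge> 2 * (pi / 2)" by (rule mult_right_mono) (use card in auto)
  finally have big: "(\<Sum>d\<in>D. pi / 2) > pi / 2" using pi_gt_zero by linarith
  have "eventually (\<lambda>s. F s > pi / 2 \<and> s > 0) (at_right 0)"
    using order_tendstoD(1)[OF lim0 big] eventually_at_right_less[of "0::real"]
    by eventually_elim auto
  then obtain s0 where s0: "F s0 > pi / 2" "s0 > 0"
    using eventually_happens trivial_limit_at_right_real by blast
  have "eventually (\<lambda>s. F s < pi / 2 \<and> s > s0) at_top"
    using order_tendstoD(2)[OF liminf pi_half_gt_zero] eventually_gt_at_top[of s0]
    by eventually_elim auto
  then obtain s1 where s1: "F s1 < pi / 2" "s1 > s0"
    by (auto simp: eventually_at_top_linorder)
  have "\<exists>s\<ge>s0. s \<le> s1 \<and> F s = pi / 2"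
  proof (rule IVT2')
    show "continuous_on {s0..s1} F"
      unfolding F_def using s0 by (intro continuous_intros) auto
  qed (use s0 s1 in auto)
  then obtain s where s: "F s = pi / 2" by blast
  have "t = s" if t: "F t = pi / 2" for t
  proof -
    have "t > 0" "s > 0" using le0[of t] le0[of s] s t pi_gt_zero by (force simp: not_le[symmetric])+
    then show ?thesis using dec[of s t] dec[of t s] s t by force
  qed
  then show ?thesis using s unfolding F_def by blast
qed

end

theory Submission
  imports Defs
begin

text \<open>
  Conjugating \<open>\<Lambda>(x)\<close> by the diagonal matrix \<open>y\<close> and composing with the reversal of darts makes it
  block diagonal, with one block for each vertex \<open>z\<close>.  Up to unit factors in front of rows and
  columns, the block of \<open>z\<close> is \<open>a\<^sub>j a\<^sub>k sgn (\<theta>\<^sub>j - \<theta>\<^sub>k)\<close>, where \<open>a\<close> are the moduli of \<open>y\<close> and \<open>\<theta>\<close> the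
  directions of the darts leaving \<open>z\<close>: halving the turning angle turns the jump of \<open>Arg\<close> by
  \<open>2 \<pi>\<close> into a sign.  Multiplied by \<open>\<i>\<close> this is a Hermitian matrix, and it has norm at most
  \<open>\<xi>\<^sup>z\<close>: if \<open>\<phi>\<^sub>j = arctan (a\<^sub>j\<^sup>2 / s)\<close> then, adding the darts in the order of their directions,
  \<open>\<Sum>\<^sub>j cot \<phi>\<^sub>j \<bar>w\<^sub>j\<bar>\<^sup>2 \<plusminus> \<i> \<Sum>\<^sub>j\<^sub>k sgn (\<theta>\<^sub>j - \<theta>\<^sub>k) cnj w\<^sub>j w\<^sub>k\<close> stays above
  \<open>cot (\<Sum>\<^sub>j \<phi>\<^sub>j) \<bar>\<Sum>\<^sub>j w\<^sub>j\<bar>\<^sup>2\<close>, which vanishes for \<open>s = \<xi>\<^sup>z\<close>.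
\<close>

section \<open>Norm of the weighted sign form\<close>

text \<open>The right side minus the left side is the squared modulus of \<open>B s u - A v\<close>
  divided by \<open>A B C\<close>, where \<open>A\<close>, \<open>B\<close>, \<open>C\<close> are
  the sines of \<open>\<alpha>\<close>, \<open>\<beta>\<close>, \<open>\<alpha> + \<beta>\<close>,
  all positive, and \<open>s\<close> is the unit number
  \<open>cis (\<alpha> + \<beta>)\<close>.\<close>

lemma cot_add_quadratic_le:
  fixes u v :: complex
  assumes "0 < \<alpha>" "0 < \<beta>" "\<alpha> + \<beta> < pi"
  shows "cot (\<alpha> + \<beta>) * (cmod (u + v))\<^sup>2
    \<le> cot \<alpha> * (cmod u)\<^sup>2 + cot \<beta> * (cmod v)\<^sup>2 + 2 * Im (cnj v * u)"
proof -
  define A B C where "A = sin \<alpha>" and "B = sin \<beta>" and "C = sin (\<alpha> + \<beta>)"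
  have pos: "A > 0" "B > 0" "C > 0"
    using assms by (auto simp: A_def B_def C_def intro!: sin_gt_zero)
  define c where "c = cos (\<alpha> + \<beta>)"
  have cC: "c\<^sup>2 + C\<^sup>2 = 1" unfolding c_def C_def by simp
  have 1: "cot \<alpha> = c / C + B / (A * C)"
  proof -
    have "cos \<alpha> * C = c * A + B"
      using sin_diff[of "\<alpha> + \<beta>" \<alpha>] by (simp add: A_def B_def C_def c_def algebra_simps)
    then show ?thesis using pos by (simp add: cot_def A_def[symmetric] field_simps)
  qed
  have 2: "cot \<beta> = c / C + A / (B * C)"
  proof -
    have "cos \<beta> * C = c * B + A"
      using sin_diff[of "\<alpha> + \<beta>" \<beta>] by (simp add: A_def B_def C_def c_def algebra_simps)
    then show ?thesis using pos by (simp add: cot_def B_def[symmetric] field_simps)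
  qed
  have 3: "cot (\<alpha> + \<beta>) = c / C" by (simp add: cot_def c_def C_def)
  define s where "s = Complex c C"
  have s1: "cmod s = 1" using cC by (simp add: s_def cmod_def)
  obtain u1 u2 v1 v2 where uv: "u = Complex u1 u2" "v = Complex v1 v2" by (metis complex.exhaust)
  have id: "cot \<alpha> * (cmod u)\<^sup>2 + cot \<beta> * (cmod v)\<^sup>2 + 2 * Im (cnj v * u)
     - cot (\<alpha> + \<beta>) * (cmod (u + v))\<^sup>2
     = (B\<^sup>2 * (cmod u)\<^sup>2 + A\<^sup>2 * (cmod v)\<^sup>2 - 2 * A * B * Re (s * cnj v * u)) / (A * B * C)"
    unfolding 1 2 3 uv s_def cmod_power2 using pos
    by (simp add: field_simps power2_eq_square)
  have "Re (s * cnj v * u) \<le> cmod v * cmod u"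
    using complex_Re_le_cmod[of "s * cnj v * u"] s1 by (simp add: norm_mult)
  then have "2 * A * B * Re (s * cnj v * u) \<le> 2 * A * B * (cmod v * cmod u)"
    using pos by (intro mult_left_mono) auto
  moreover have "0 \<le> (B * cmod u - A * cmod v)\<^sup>2" by simp
  ultimately have "0 \<le> B\<^sup>2 * (cmod u)\<^sup>2 + A\<^sup>2 * (cmod v)\<^sup>2 - 2 * A * B * Re (s * cnj v * u)"
    by (simp add: power2_eq_square algebra_simps)
  then show ?thesis using id pos
    by (smt (verit, ccfv_threshold) divide_nonneg_pos mult_pos_pos)
qed

text \<open>A skew-Hermitian form, conjugate-linear in \<open>u\<close>. Its values at
  \<open>u = v\<close> are purely imaginary, hence the bounds on \<open>Im\<close> below. Since
  \<open>sgn 0 = 0\<close>, the diagonal is left out, just as the transition matrix leaves out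
  backtracking.\<close>

definition sgn_form :: "('a \<Rightarrow> real) \<Rightarrow> 'a set \<Rightarrow> ('a \<Rightarrow> complex) \<Rightarrow> ('a \<Rightarrow> complex) \<Rightarrow> complex" where
  "sgn_form \<theta> D u v = (\<Sum>j\<in>D. \<Sum>k\<in>D. of_real (sgn (\<theta> j - \<theta> k)) * (cnj (u j) * v k))"

text \<open>Elements are added in increasing order of \<open>\<theta>\<close>. The new one then has
  the same sign against all earlier ones, so its cross terms see them only through their sum, and
  the inequality for two vectors applies to that sum and the new entry.\<close>

lemma cot_sum_le_sgn_form:
  fixes \<theta> :: "'a \<Rightarrow> real" and w :: "'a \<Rightarrow> complex"
  assumes "finite D" and "D \<noteq> {}" and "inj_on \<theta> D"
    and "\<And>j. j \<in> D \<Longrightarrow> 0 < \<phi> j" and "(\<Sum>j\<in>D. \<phi> j) < pi"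
  shows "cot (\<Sum>j\<in>D. \<phi> j) * (cmod (\<Sum>j\<in>D. w j))\<^sup>2
    \<le> (\<Sum>j\<in>D. cot (\<phi> j) * (cmod (w j))\<^sup>2) + Im (sgn_form \<theta> D w w)"
  using assms
proof (induction D rule: finite_ranking_induct[where f = \<theta>])
  case empty
  then show ?case by simp
next
  case (insert x S)
  \<comment> \<open>The induction rule does not exclude \<open>x \<in> S\<close>, and the induction
    hypothesis speaks only of nonempty \<open>S\<close>, which makes the singleton the true base
    case.\<close>
  consider "x \<in> S" | "S = {}" | "x \<notin> S" "S \<noteq> {}" by blast
  then show ?case
  proof cases
    case 1
    then have "insert x S = S" by blast
    then show ?thesis using insert.IH insert.prems by simp
  next
    case 2
    then show ?thesis by (simp add: sgn_form_def)
  next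
    case 3
    note xS = 3(1) and False = 3(2)
    have sg: "sgn (\<theta> x - \<theta> k) = 1" "sgn (\<theta> k - \<theta> x) = -1" if "k \<in> S" for k
    proof -
      have "\<theta> k \<noteq> \<theta> x" using insert.prems(2) that xS by (auto simp: inj_on_def)
      moreover have "\<theta> k \<le> \<theta> x" using insert.hyps that by auto
      ultimately show "sgn (\<theta> x - \<theta> k) = 1" "sgn (\<theta> k - \<theta> x) = -1" by auto
    qed
    have pos: "0 < (\<Sum>j\<in>S. \<phi> j)"
      using insert.prems insert.hyps False by (intro sum_pos) auto
    have px: "0 < \<phi> x" using insert.prems by auto
    have "(\<Sum>j\<in>S. \<phi> j) < pi" using insert.prems(4) insert.hyps px xS by simp
    then have IH: "cot (\<Sum>j\<in>S. \<phi> j) * (cmod (\<Sum>j\<in>S. w j))\<^sup>2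
      \<le> (\<Sum>j\<in>S. cot (\<phi> j) * (cmod (w j))\<^sup>2) + Im (sgn_form \<theta> S w w)"
      using insert.prems insert.hyps False px xS by (intro insert.IH) auto
    define s where "s = (\<Sum>j\<in>S. w j)"
    have "sgn_form \<theta> (insert x S) w w
      = (\<Sum>k\<in>S. cnj (w x) * w k) + (\<Sum>j\<in>S. - (cnj (w j) * w x)) + sgn_form \<theta> S w w"
      using insert.hyps xS
      by (simp add: sgn_form_def sum.distrib sg cong: sum.cong)
    also have "\<dots> = cnj (w x) * s - cnj s * w x + sgn_form \<theta> S w w"
      by (simp add: s_def sum_distrib_left sum_distrib_right sum_negf)
    finally have F: "Im (sgn_form \<theta> (insert x S) w w) = 2 * Im (cnj (w x) * s) + Im (sgn_form \<theta> S w w)"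
      by simp
    have "cot ((\<Sum>j\<in>S. \<phi> j) + \<phi> x) * (cmod (s + w x))\<^sup>2
      \<le> cot (\<Sum>j\<in>S. \<phi> j) * (cmod s)\<^sup>2 + cot (\<phi> x) * (cmod (w x))\<^sup>2 + 2 * Im (cnj (w x) * s)"
      using pos px insert.prems insert.hyps xS by (intro cot_add_quadratic_le) (auto simp: add.commute)
    then show ?thesis using IH F insert.hyps xS
      by (simp add: s_def[symmetric] add.commute)
  qed
qed

text \<open>The lower bound vanishes because \<open>cot (pi / 2) = 0\<close>. Negating
  \<open>\<theta>\<close> reverses the order and flips the sign of the form, which gives the other
  half of the absolute value.\<close>

lemma abs_sgn_form_le:
  fixes \<theta> :: "'a \<Rightarrow> real" and w :: "'a \<Rightarrow> complex"
  assumes fin: "finite D" and inj: "inj_on \<theta> D"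
    and pos: "\<And>j. j \<in> D \<Longrightarrow> 0 < \<phi> j" and sum: "(\<Sum>j\<in>D. \<phi> j) = pi / 2"
  shows "\<bar>Im (sgn_form \<theta> D w w)\<bar> \<le> (\<Sum>j\<in>D. cot (\<phi> j) * (cmod (w j))\<^sup>2)"
proof -
  have ne: "D \<noteq> {}" using sum pi_gt_zero by force
  have "Im (sgn_form (\<lambda>j. - \<theta> j) D w w) = - Im (sgn_form \<theta> D w w)"
  proof -
    have neg: "sgn (- \<theta> j - - \<theta> k) = - sgn (\<theta> j - \<theta> k)" for j k
      by (simp add: sgn_if)
    show ?thesis unfolding sgn_form_def neg by (simp add: sum_negf)
  qed
  moreover have "0 \<le> (\<Sum>j\<in>D. cot (\<phi> j) * (cmod (w j))\<^sup>2) + Im (sgn_form \<tau> D w w)"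
    if "inj_on \<tau> D" for \<tau>
    using cot_sum_le_sgn_form[OF fin ne that, of \<phi> w] pos sum by (simp add: cot_def)
  from this[OF inj] this[of "\<lambda>j. - \<theta> j"]
  have "0 \<le> (\<Sum>j\<in>D. cot (\<phi> j) * (cmod (w j))\<^sup>2) + Im (sgn_form \<theta> D w w)"
    "0 \<le> (\<Sum>j\<in>D. cot (\<phi> j) * (cmod (w j))\<^sup>2) + Im (sgn_form (\<lambda>j. - \<theta> j) D w w)"
    using inj by (auto simp: inj_on_def)
  ultimately show ?thesis by linarith
qed

lemma sgn_form_commute: "sgn_form \<theta> D v u = - cnj (sgn_form \<theta> D u v)"
proof -
  have s: "sgn (\<theta> k - \<theta> j) = - sgn (\<theta> j - \<theta> k)" for j k
    by (metis minus_diff_eq sgn_minus)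
  have "sgn_form \<theta> D v u = (\<Sum>k\<in>D. \<Sum>j\<in>D. of_real (sgn (\<theta> j - \<theta> k)) * (cnj (v j) * u k))"
    unfolding sgn_form_def by (rule sum.swap)
  also have "\<dots> = - cnj (sgn_form \<theta> D u v)"
    unfolding sgn_form_def
    by (subst s) (simp add: sum_negf mult.commute)
  finally show ?thesis .
qed

lemma sgn_form_scale: "sgn_form \<theta> D u (\<lambda>j. c * v j) = c * sgn_form \<theta> D u v"
  by (simp add: sgn_form_def sum_distrib_left mult_ac)

text \<open>Since \<open>\<i>\<close> times the form is Hermitian, its quadratic bound extends to
  pairs by polarization. The bound is kept as a sum of squares instead of a product of norms, so
  that it can later be added over all vertices.\<close>

lemma cmod_sgn_form_le:
  fixes \<theta> :: "'a \<Rightarrow> real" and u v :: "'a \<Rightarrow> complex"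
  assumes fin: "finite D" and inj: "inj_on \<theta> D" and s: "0 < s"
    and a: "\<And>j. j \<in> D \<Longrightarrow> 0 < a j" and sum: "(\<Sum>j\<in>D. arctan ((a j)\<^sup>2 / s)) = pi / 2"
  shows "cmod (sgn_form \<theta> D (\<lambda>j. of_real (a j) * u j) (\<lambda>j. of_real (a j) * v j))
    \<le> s / 2 * ((\<Sum>j\<in>D. (cmod (u j))\<^sup>2) + (\<Sum>j\<in>D. (cmod (v j))\<^sup>2))"
proof -
  define F where "F u v = sgn_form \<theta> D (\<lambda>j. of_real (a j) * u j) (\<lambda>j. of_real (a j) * v j)" for u v
  have quad: "\<bar>Im (F w w)\<bar> \<le> s * (\<Sum>j\<in>D. (cmod (w j))\<^sup>2)" for w
  proof -
    have "\<bar>Im (F w w)\<bar>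
      \<le> (\<Sum>j\<in>D. cot (arctan ((a j)\<^sup>2 / s)) * (cmod (of_real (a j) * w j))\<^sup>2)"
      unfolding F_def
      by (intro abs_sgn_form_le[OF fin inj _ sum]) (use a s in \<open>simp add: less_imp_neq[symmetric]\<close>)
    \<comment> \<open>The angles are chosen so that \<open>cot\<close> of the arctangent is
      \<open>s / (a j)\<^sup>2\<close>, which cancels the weight.\<close>
    also have "\<dots> = (\<Sum>j\<in>D. s * (cmod (w j))\<^sup>2)"
    proof (rule sum.cong[OF refl])
      fix j assume "j \<in> D"
      then show "cot (arctan ((a j)\<^sup>2 / s)) * (cmod (of_real (a j) * w j))\<^sup>2 = s * (cmod (w j))\<^sup>2"
        using a[of j] s by (simp add: cot_altdef tan_arctan norm_mult power_mult_distrib)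
    qed
    finally show ?thesis by (simp add: sum_distrib_left)
  qed
  have lin: "F (\<lambda>j. u j + v j) (\<lambda>j. u j + v j) = F u u + F u v + F v u + F v v"
    "F (\<lambda>j. u j - v j) (\<lambda>j. u j - v j) = F u u - F u v - F v u + F v v" for u v
    by (simp_all add: F_def sgn_form_def algebra_simps sum.distrib sum_subtractf)
  have Im_le: "Im (F u v) \<le> s / 2 * ((\<Sum>j\<in>D. (cmod (u j))\<^sup>2) + (\<Sum>j\<in>D. (cmod (v j))\<^sup>2))" for u v
  proof -
    \<comment> \<open>By skew-Hermitian symmetry both mixed terms have the same imaginary part, so
      polarization needs only \<open>u + v\<close> and \<open>u - v\<close>; the parallelogram law
      then evaluates the bound.\<close>
    have "Im (F v u) = Im (F u v)"
      unfolding F_def by (subst sgn_form_commute) simp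
    then have "4 * Im (F u v) = Im (F (\<lambda>j. u j + v j) (\<lambda>j. u j + v j))
        - Im (F (\<lambda>j. u j - v j) (\<lambda>j. u j - v j))"
      by (simp add: lin)
    also have "\<dots> \<le> s * (\<Sum>j\<in>D. (cmod (u j + v j))\<^sup>2) + s * (\<Sum>j\<in>D. (cmod (u j - v j))\<^sup>2)"
      using quad[of "\<lambda>j. u j + v j"] quad[of "\<lambda>j. u j - v j"] by linarith
    also have "\<dots> = s * (\<Sum>j\<in>D. (cmod (u j + v j))\<^sup>2 + (cmod (u j - v j))\<^sup>2)"
      by (simp add: sum.distrib distrib_left)
    also have "\<dots> = s * (\<Sum>j\<in>D. 2 * (cmod (u j))\<^sup>2 + 2 * (cmod (v j))\<^sup>2)"
    proof -
      have "(cmod (p + q))\<^sup>2 + (cmod (p - q))\<^sup>2 = 2 * (cmod p)\<^sup>2 + 2 * (cmod q)\<^sup>2" for p q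
        unfolding cmod_power2 by (simp add: power2_eq_square algebra_simps)
      then show ?thesis by simp
    qed
    also have "\<dots> = 2 * s * ((\<Sum>j\<in>D. (cmod (u j))\<^sup>2) + (\<Sum>j\<in>D. (cmod (v j))\<^sup>2))"
      by (simp add: sum.distrib sum_distrib_left[symmetric] algebra_simps)
    finally show ?thesis by simp
  qed
  show ?thesis
  proof (cases "F u v = 0")
    case True
    then show ?thesis using s by (simp add: F_def[symmetric] sum_nonneg)
  next
    case False
    \<comment> \<open>Multiplying \<open>v\<close> by this unit number turns the form into
      \<open>\<i>\<close> times its modulus, so the bound on the imaginary part becomes one on the
      modulus.\<close>
    define c where "c = \<i> * cnj (sgn (F u v))"
    have c1: "cmod c = 1" using False by (simp add: c_def norm_mult norm_sgn)
    have "F u (\<lambda>j. c * v j) = c * F u v"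
      unfolding F_def by (subst sgn_form_scale[symmetric]) (simp add: mult_ac)
    also have "\<dots> = \<i> * of_real (cmod (F u v))"
    proof -
      have "cnj (sgn z) * z = of_real (cmod z)" for z :: complex
      proof (cases "z = 0")
        case False
        have "cnj (sgn z) * z = z * cnj z / of_real (cmod z)"
          by (simp add: sgn_eq)
        also have "\<dots> = of_real (cmod z)"
          using False by (simp add: complex_norm_square[symmetric] power2_eq_square)
        finally show ?thesis .
      qed simp
      then show ?thesis by (simp add: c_def mult.assoc)
    qed
    finally have "cmod (F u v) = Im (F u (\<lambda>j. c * v j))" by simp
    also have "\<dots> \<le> s / 2 * ((\<Sum>j\<in>D. (cmod (u j))\<^sup>2) + (\<Sum>j\<in>D. (cmod (c * v j))\<^sup>2))"
      by (rule Im_le)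
    finally show ?thesis using c1 by (simp add: F_def norm_mult)
  qed
qed

section \<open>Turning angles and directions at a vertex\<close>

definition direction :: "dart \<Rightarrow> real" where
  "direction d = Arg (head d - tail d)"

text \<open>The reversal of \<open>d\<close> points opposite to \<open>d\<close>, so the turning
  angle is the difference of the directions shifted by \<open>pi\<close> up or down; halving makes
  this shift a factor \<open>\<i>\<close> or \<open>- \<i>\<close>.\<close>

lemma exp_half_turning_angle:
  assumes "tail d = tail g" and ne: "head d \<noteq> tail d" "head g \<noteq> tail g"
    and dir: "direction d \<noteq> direction g"
  shows "exp (\<i> / 2 * of_real (turning_angle (reversal d) g))
    = \<i> * of_real (sgn (direction d - direction g)) * cnj (cis (direction d / 2)) * cis (direction g / 2)"
proof -
  define a b where "a = direction d" and "b = direction g"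
  have ab: "-pi < a" "a \<le> pi" "-pi < b" "b \<le> pi"
    using Arg_bounded[of "head d - tail d"] Arg_bounded[of "head g - tail g"]
    by (auto simp: a_def b_def direction_def)
  have D: "head d - tail d = of_real (cmod (head d - tail d)) * cis a"
    and G: "head g - tail g = of_real (cmod (head g - tail g)) * cis b"
    by (simp_all add: a_def b_def direction_def rcis_cmod_Arg[unfolded rcis_def])
  \<comment> \<open>The shift is downwards exactly when \<open>a < b\<close>: this is the choice
    that brings \<open>b - a\<close>, which lies between \<open>-2 pi\<close> and
    \<open>2 pi\<close>, into the range of \<open>Arg\<close>.\<close>
  define t where "t = b - a + sgn (a - b) * pi"
  have ne_ab: "a \<noteq> b" using dir by (simp add: a_def b_def)
  have t: "-pi < t" "t \<le> pi" using ab ne_ab by (auto simp: t_def sgn_if)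
  have cis_t: "cis t = - (cis b / cis a)"
  proof (cases "a < b")
    case True
    then have "t = (b - a) - pi" by (simp add: t_def)
    then show ?thesis by (simp only: cis_divide[symmetric]) simp
  next
    case False
    then have "t = (b - a) + pi" using ne_ab by (simp add: t_def)
    then show ?thesis by (simp only: cis_divide[symmetric] cis_mult[symmetric]) simp
  qed
  define r where "r = cmod (head g - tail g) / cmod (head d - tail d)"
  have r: "r > 0" using ne by (simp add: r_def)
  have "(head g - tail g) / (tail d - head d) = of_real r * cis t"
  proof -
    have "(head g - tail g) / (tail d - head d) = - ((head g - tail g) / (head d - tail d))"
      by (metis minus_diff_eq divide_minus_right)
    also have "\<dots> = of_real r * cis t"
      unfolding cis_t by (subst D, subst G) (simp add: r_def)
    finally show ?thesis .
  qed
  then have "turning_angle (reversal d) g = Arg (of_real r * cis t)"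
    by (simp add: turning_angle_def)
  also have "\<dots> = t" using r t
    by (metis Arg_times_of_real Arg_cis greaterThanAtMost_iff)
  finally have "exp (\<i> / 2 * of_real (turning_angle (reversal d) g)) = cis (t / 2)"
    by (simp add: cis_conv_exp)
  also have "t / 2 = sgn (a - b) * (pi / 2) + (- (a / 2) + b / 2)" by (simp add: t_def field_simps)
  also have "cis \<dots> = cis (sgn (a - b) * (pi / 2)) * (cis (- (a / 2)) * cis (b / 2))"
    by (simp only: cis_mult)
  also have "cis (sgn (a - b) * (pi / 2)) = \<i> * of_real (sgn (a - b))"
    using ne_ab by (auto simp: sgn_if complex_eq_iff)
  finally show ?thesis by (simp add: a_def b_def cis_cnj mult_ac)
qed

lemma head_ne_tail:
  assumes "embedded_graph V E" and "d \<in> darts E"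
  shows "head d \<noteq> tail d" and "head d \<in> V" and "tail d \<in> V"
proof -
  have "undirected d \<in> E" using assms(2) by (simp add: darts_def)
  then obtain z w where "z \<in> V" "w \<in> V" "z \<noteq> w" "undirected d = {z, w}"
    using assms(1) unfolding embedded_graph_def by meson
  then show "head d \<noteq> tail d" and "head d \<in> V" and "tail d \<in> V"
    by (auto simp: doubleton_eq_iff)
qed

text \<open>This supplies the strict ranking behind the sign form: for two darts with equal
  direction the sign would vanish while the transition entry would not.\<close>

lemma inj_on_direction:
  assumes G: "embedded_graph V E"
  shows "inj_on direction (out_darts E z)"
proof (rule inj_onI, rule ccontr)
  fix d g
  assume d: "d \<in> out_darts E z" and g: "g \<in> out_darts E z"
    and eq: "direction d = direction g" and "d \<noteq> g"
  \<comment> \<open>the shorter edge ends inside the longer one\<close>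
  have *: False if d: "d \<in> out_darts E z" and g: "g \<in> out_darts E z"
    and eq: "direction d = direction g" and ne: "d \<noteq> g"
    and le: "cmod (head g - z) \<le> cmod (head d - z)" for d g
  proof -
    have dE: "d \<in> darts E" "g \<in> darts E" and tl: "tail d = z" "tail g = z"
      using d g by (auto simp: out_darts_def)
    have nz: "head d \<noteq> z" "head g \<noteq> z" using head_ne_tail(1)[OF G dE(1)] head_ne_tail(1)[OF G dE(2)] tl by simp_all
    define t where "t = cmod (head g - z) / cmod (head d - z)"
    have t: "0 \<le> t" "t \<le> 1" using nz le by (auto simp: t_def)
    have "head g - z = of_real (cmod (head g - z)) * cis (direction d)"
      "head d - z = of_real (cmod (head d - z)) * cis (direction d)"
      using eq tl rcis_cmod_Arg[of "head g - z"] rcis_cmod_Arg[of "head d - z"]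
      by (simp_all add: direction_def rcis_def)
    then have "head g - z = of_real t * (head d - z)"
      unfolding t_def using nz
      by (metis (no_types, lifting) eq_iff_diff_eq_0 mult.assoc nonzero_eq_divide_eq norm_eq_zero
          of_real_divide of_real_eq_0_iff)
    then have "head g = (1 - t) *\<^sub>R z + t *\<^sub>R head d"
      by (simp add: scaleR_conv_of_real algebra_simps)
    then have "head g \<in> convex hull {z, head d}"
      unfolding segment_convex_hull[symmetric] closed_segment_def using t by auto
    moreover have "{z, head d} \<in> E" using dE tl by (auto simp: darts_def)
    then have "convex hull {z, head d} \<inter> V = {z, head d}"
      using G by (simp add: embedded_graph_def)
    ultimately have "head g \<in> {z, head d}"
      using head_ne_tail(2)[OF G dE(2)] by (metis IntI)
    then have "head g = head d" using nz by auto
    then show False using ne tl by (auto simp: prod_eq_iff)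
  qed
  show False
    using *[OF d g eq \<open>d \<noteq> g\<close>] *[OF g d eq[symmetric] \<open>d \<noteq> g\<close>[symmetric]] by linarith
qed

section \<open>The block of a single vertex\<close>

lemma xi_equation:
  assumes "card (out_darts E z) > 1" and "\<And>d. d \<in> out_darts E z \<Longrightarrow> y d \<noteq> 0"
  shows "(\<Sum>d\<in>out_darts E z. arctan ((cmod (y d))\<^sup>2 / xi E y z)) = pi / 2"
    and "0 < xi E y z"
proof -
  have "\<exists>!s. (\<Sum>d\<in>out_darts E z. arctan ((cmod (y d))\<^sup>2 / s)) = pi / 2"
    using assms by (intro xi_equation_ex1) auto
  from theI'[OF this] show eq: "(\<Sum>d\<in>out_darts E z. arctan ((cmod (y d))\<^sup>2 / xi E y z)) = pi / 2"
    using assms(1) by (simp add: xi_def)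
  show "0 < xi E y z"
  proof (rule ccontr)
    \<comment> \<open>The value 0 is covered too: division by 0 yields 0, so no summand is
      positive.\<close>
    assume "\<not> 0 < xi E y z"
    then have "(\<Sum>d\<in>out_darts E z. arctan ((cmod (y d))\<^sup>2 / xi E y z)) \<le> 0"
      by (intro sum_nonpos) (auto simp: divide_le_0_iff)
    then show False using eq pi_gt_zero by linarith
  qed
qed

lemma xi_nonneg:
  assumes "\<And>d. d \<in> out_darts E z \<Longrightarrow> y d \<noteq> 0"
  shows "0 \<le> xi E y z"
  using xi_equation(2)[of E z y] assms by (cases "card (out_darts E z) > 1") (auto simp: xi_def)

lemma finite_darts:
  assumes "embedded_graph V E"
  shows "finite (darts E)"
proof (rule finite_subset)
  show "darts E \<subseteq> V \<times> V" using head_ne_tail[OF assms] by (auto simp: mem_Times_iff)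
  show "finite (V \<times> V)" using assms by (simp add: embedded_graph_def)
qed

lemma reversal_in_darts [simp]: "reversal d \<in> darts E \<longleftrightarrow> d \<in> darts E"
  by (simp add: darts_def insert_commute)

lemma sum_darts_reversal: "(\<Sum>d\<in>darts E. h (reversal d)) = (\<Sum>d\<in>darts E. h d)"
  by (rule sum.reindex_bij_witness[of _ prod.swap prod.swap]) auto

text \<open>The phases of \<open>y\<close> and the half-direction factors have modulus 1 and are
  absorbed into the vectors without changing their norms. What remains is the sign form weighted by
  the moduli of \<open>y\<close>.\<close>

lemma cmod_vertex_block_le:
  fixes p q :: "dart \<Rightarrow> complex"
  assumes G: "embedded_graph V E" and y: "\<And>d. d \<in> darts E \<Longrightarrow> y d \<noteq> 0"
  shows "cmod (\<Sum>d\<in>out_darts E z. \<Sum>g\<in>out_darts E z. q d *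
      (if g = d then 0 else y d * y g * exp (\<i> / 2 * of_real (turning_angle (reversal d) g))) * p g)
    \<le> xi E y z / 2 * ((\<Sum>d\<in>out_darts E z. (cmod (q d))\<^sup>2) + (\<Sum>d\<in>out_darts E z. (cmod (p d))\<^sup>2))"
    (is "cmod (\<Sum>d\<in>?D. \<Sum>g\<in>?D. ?T d g) \<le> _")
proof -
  have fin: "finite ?D" using finite_darts[OF G] by (auto simp: out_darts_def)
  have yD: "y d \<noteq> 0" if "d \<in> ?D" for d using that y by (auto simp: out_darts_def)
  show ?thesis
  proof (cases "card ?D > 1")
    case False
    \<comment> \<open>With at most one dart leaving \<open>z\<close>, only the backtracking pair is
      possible, and the block is 0, in accordance with the value 0 of \<open>xi\<close>.\<close>
    have "?T d g = 0" if "d \<in> ?D" "g \<in> ?D" for d g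
      using False fin that card_le_Suc0_iff_eq[of ?D] by auto
    then have "(\<Sum>d\<in>?D. \<Sum>g\<in>?D. ?T d g) = 0" by simp
    then show ?thesis using False by (simp add: xi_def)
  next
    case True
    \<comment> \<open>The outer \<open>cnj\<close> compensates the conjugation of the first argument
      in \<open>sgn_form\<close>.\<close>
    define u where "u d = cnj (\<i> * q d * cnj (cis (direction d / 2)) * sgn (y d))" for d
    define v where "v g = cis (direction g / 2) * sgn (y g) * p g" for g
    have inj: "inj_on direction ?D" by (rule inj_on_direction[OF G])
    have T: "?T d g = of_real (sgn (direction d - direction g)) *
        (cnj (of_real (cmod (y d)) * u d) * (of_real (cmod (y g)) * v g))"
      if d: "d \<in> ?D" and g: "g \<in> ?D" for d g
    proof (cases "g = d")
      case False
      have pol: "w = of_real (cmod w) * sgn w" for w :: complex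
        by (cases "w = 0") (simp_all add: sgn_eq)
      have "exp (\<i> / 2 * of_real (turning_angle (reversal d) g))
        = \<i> * of_real (sgn (direction d - direction g)) * cnj (cis (direction d / 2)) * cis (direction g / 2)"
      proof (rule exp_half_turning_angle)
        show "direction d \<noteq> direction g" using inj_onD[OF inj _ d g] False by blast
      qed (use d g head_ne_tail(1)[OF G, of d] head_ne_tail(1)[OF G, of g] in
          \<open>auto simp: out_darts_def\<close>)
      then show ?thesis using False
        by (subst (1) pol[of "y d"], subst (1) pol[of "y g"]) (simp add: u_def v_def mult_ac)
    qed simp
    have nu: "cmod (u d) = cmod (q d)" "cmod (v d) = cmod (p d)" if "d \<in> ?D" for d
      using yD[OF that] by (simp_all add: u_def v_def norm_mult norm_sgn)
    have "(\<Sum>d\<in>?D. \<Sum>g\<in>?D. ?T d g) = sgn_form direction ?D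
        (\<lambda>j. of_real (cmod (y j)) * u j) (\<lambda>j. of_real (cmod (y j)) * v j)"
      unfolding sgn_form_def using T by (intro sum.cong refl) blast
    also have "cmod \<dots> \<le> xi E y z / 2 * ((\<Sum>d\<in>?D. (cmod (u d))\<^sup>2) + (\<Sum>d\<in>?D. (cmod (v d))\<^sup>2))"
      using xi_equation[OF True yD] yD by (intro cmod_sgn_form_le[OF fin inj]) auto
    finally show ?thesis by (simp add: nu)
  qed
qed

section \<open>From the vertex blocks to the spectral radius\<close>

text \<open>Pairing the rescaled eigenvector equation with the conjugate of the same vector gives
  \<open>k * N\<close> on one side and a sum of vertex blocks on the other. Each dart lies in
  exactly one block, so the block bounds add up to \<open>M * N\<close>.\<close>

lemma transition_eigenvalue_le:
  fixes f :: "dart \<Rightarrow> complex"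
  assumes G: "embedded_graph V E" and y: "\<And>d. d \<in> darts E \<Longrightarrow> y d \<noteq> 0"
    and fact: "factorizes E x y" and M: "\<And>z. z \<in> V \<Longrightarrow> xi E y z \<le> M"
    and ev: "\<And>d. d \<in> darts E \<Longrightarrow> (\<Sum>g\<in>darts E. transition_entry x d g * f g) = k * f d"
    and f: "\<exists>d\<in>darts E. f d \<noteq> 0"
  shows "cmod k \<le> M"
proof -
  have finV: "finite V" using G by (simp add: embedded_graph_def)
  have finE: "finite (darts E)" by (rule finite_darts[OF G])
  have finO: "finite (out_darts E z)" for z using finE by (auto simp: out_darts_def)
  \<comment> \<open>Rescaling by \<open>y\<close> replaces the weight in row
    \<open>reversal d\<close> by \<open>x (undirected d) * y g / y (reversal d)\<close>, which
    factorization turns into the symmetric \<open>y d * y g\<close>.\<close>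
  define p where "p d = f d / y d" for d
  define N where "N = (\<Sum>d\<in>darts E. (cmod (p d))\<^sup>2)"
  have group: "(\<Sum>d\<in>darts E. h d) = (\<Sum>z\<in>V. \<Sum>d\<in>out_darts E z. h d)" for h :: "dart \<Rightarrow> 'b::comm_monoid_add"
    unfolding out_darts_def using sum.group[OF finE finV, of fst h] head_ne_tail[OF G] by force
  have N: "N > 0"
  proof -
    obtain d where "d \<in> darts E" "f d \<noteq> 0" using f by blast
    then show ?thesis
      unfolding N_def using y[of d] by (intro sum_pos2[OF finE, of d]) (simp_all add: p_def)
  qed
  \<comment> \<open>The entry in row \<open>reversal d\<close> and column \<open>g\<close>, for
    \<open>d\<close> and \<open>g\<close> with common tail; backtracking from
    \<open>reversal d\<close> means \<open>g = d\<close>.\<close>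
  define e where "e d g = (if g = d then 0 else y d * y g *
    exp (\<i> / 2 * of_real (turning_angle (reversal d) g)))" for d g
  define q where "q d = cnj (p (reversal d))" for d
  have step: "k * p (reversal d) = (\<Sum>g\<in>out_darts E (tail d). e d g * p g)" if d: "d \<in> darts E" for d
  proof -
    have r: "reversal d \<in> darts E" using d by simp
    have xy: "x (undirected (reversal d)) = y d * y (reversal d)"
      using fact d unfolding factorizes_def by (simp add: insert_commute)
    have yr: "y (reversal d) \<noteq> 0" using y r by blast
    have "k * p (reversal d) = (\<Sum>g\<in>darts E. transition_entry x (reversal d) g * f g) / y (reversal d)"
      using ev[OF r] by (simp add: p_def)
    also have "\<dots> = (\<Sum>g\<in>darts E. if tail g = tail d then e d g * p g else 0)"
      unfolding sum_divide_distrib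
    proof (rule sum.cong[OF refl])
      fix g assume "g \<in> darts E"
      then show "transition_entry x (reversal d) g * f g / y (reversal d)
          = (if tail g = tail d then e d g * p g else 0)"
        using y yr unfolding transition_entry_def xy by (auto simp: e_def p_def)
    qed
    also have "\<dots> = (\<Sum>g\<in>out_darts E (tail d). e d g * p g)"
      unfolding out_darts_def using finE by (simp add: sum.inter_filter)
    finally show ?thesis .
  qed
  have "k * of_real N = (\<Sum>d\<in>darts E. k * (q d * p (reversal d)))"
  proof -
    have "N = (\<Sum>d\<in>darts E. (cmod (p (reversal d)))\<^sup>2)"
      unfolding N_def by (rule sum_darts_reversal[symmetric])
    then show ?thesis
      by (simp add: sum_distrib_left complex_norm_square q_def mult_ac del: of_real_power)
  qed
  also have "\<dots> = (\<Sum>d\<in>darts E. \<Sum>g\<in>out_darts E (tail d). q d * e d g * p g)"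
  proof (rule sum.cong[OF refl])
    fix d assume "d \<in> darts E"
    then have "k * (q d * p (reversal d)) = q d * (\<Sum>g\<in>out_darts E (tail d). e d g * p g)"
      by (simp flip: step)
    then show "k * (q d * p (reversal d)) = (\<Sum>g\<in>out_darts E (tail d). q d * e d g * p g)"
      by (simp add: sum_distrib_left mult.assoc)
  qed
  also have "\<dots> = (\<Sum>z\<in>V. \<Sum>d\<in>out_darts E z. \<Sum>g\<in>out_darts E z. q d * e d g * p g)"
    unfolding group by (intro sum.cong refl) (auto simp: out_darts_def)
  finally have "cmod k * N = cmod (\<Sum>z\<in>V. \<Sum>d\<in>out_darts E z. \<Sum>g\<in>out_darts E z. q d * e d g * p g)"
    using N by (metis abs_of_pos norm_mult norm_of_real)
  also have "\<dots> \<le> (\<Sum>z\<in>V. cmod (\<Sum>d\<in>out_darts E z. \<Sum>g\<in>out_darts E z. q d * e d g * p g))"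
    by (rule norm_sum)
  also have "\<dots> \<le> (\<Sum>z\<in>V. M / 2 *
      ((\<Sum>d\<in>out_darts E z. (cmod (q d))\<^sup>2) + (\<Sum>d\<in>out_darts E z. (cmod (p d))\<^sup>2)))"
  proof (rule sum_mono)
    fix z assume "z \<in> V"
    then have "xi E y z / 2 \<le> M / 2" using M by simp
    then show "cmod (\<Sum>d\<in>out_darts E z. \<Sum>g\<in>out_darts E z. q d * e d g * p g) \<le> M / 2 *
        ((\<Sum>d\<in>out_darts E z. (cmod (q d))\<^sup>2) + (\<Sum>d\<in>out_darts E z. (cmod (p d))\<^sup>2))"
      unfolding e_def
      by (intro order_trans[OF cmod_vertex_block_le[OF G y] mult_right_mono] add_nonneg_nonneg sum_nonneg)
        simp_all
  qed
  also have "\<dots> = M / 2 * ((\<Sum>d\<in>darts E. (cmod (q d))\<^sup>2) + (\<Sum>d\<in>darts E. (cmod (p d))\<^sup>2))"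
    unfolding group by (simp only: sum_distrib_left[symmetric] sum.distrib)
  also have "\<dots> = M * N"
    using sum_darts_reversal[of "\<lambda>d. (cmod (p d))\<^sup>2" E] by (simp add: q_def N_def)
  finally show ?thesis using N by simp
qed

theorem corollary2p6:
  fixes V :: "complex set" and E :: "complex set set" and ds :: "dart list"
    and x :: "complex set \<Rightarrow> complex" and y :: "dart \<Rightarrow> complex"
  assumes "embedded_graph V E" and "V \<noteq> {}"
    and "distinct ds" and "set ds = darts E"
    and "\<And>e. e \<in> E \<Longrightarrow> x e \<noteq> 0"
    and "\<And>d. d \<in> darts E \<Longrightarrow> y d \<noteq> 0"
    and "factorizes E x y"
  shows "spec_rad (transition_matrix ds x) \<le> (MAX z\<in>V. xi E y z)"
proof (cases "ds = []")
  case True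
  have finV: "finite V" using assms(1) by (simp add: embedded_graph_def)
  obtain z where z: "z \<in> V" using assms(2) by blast
  \<comment> \<open>Without darts the spectral radius is 0 by convention, so the maximum only has to
    be nonnegative.\<close>
  have "0 \<le> xi E y z" using assms(6) by (intro xi_nonneg) (auto simp: out_darts_def)
  also have "\<dots> \<le> (MAX z\<in>V. xi E y z)" using finV z by (intro Max_ge) auto
  finally show ?thesis using True by (simp add: spec_rad_def transition_matrix_def)
next
  case False
  define n where "n = length ds"
  define A where "A = transition_matrix ds x"
  have finV: "finite V" using assms(1) by (simp add: embedded_graph_def)
  have A: "A \<in> carrier_mat n n" and n: "n > 0"
    using False by (simp_all add: A_def n_def transition_matrix_def)
  obtain k v where kv: "eigenvector A v k" and rho: "spectral_radius A = cmod k"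
    using spectral_radius_mem_max(1)[OF A n] by (auto simp: spectrum_def eigenvalue_def)
  have v: "v \<in> carrier_vec n" "v \<noteq> 0\<^sub>v n" and Av: "A *\<^sub>v v = k \<cdot>\<^sub>v v"
    using kv A by (auto simp: eigenvector_def)
  have bij: "bij_betw ((!) ds) {..<n} (darts E)"
    using bij_betw_nth[OF assms(3), of "{..<n}" "darts E"] assms(4) by (simp add: n_def)
  \<comment> \<open>The eigenvector is carried from list positions to darts by inverting the
    enumeration \<open>ds\<close>.\<close>
  define f where "f d = v $ the_inv_into {..<n} ((!) ds) d" for d
  have f_nth: "f (ds ! i) = v $ i" if "i < n" for i
    unfolding f_def using the_inv_into_f_f[OF bij_betw_imp_inj_on[OF bij], of i] that by simp
  have "cmod k \<le> (MAX z\<in>V. xi E y z)"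
  proof (rule transition_eigenvalue_le[OF assms(1,6,7)])
    show "xi E y z \<le> (MAX z\<in>V. xi E y z)" if "z \<in> V" for z
      using finV that by (intro Max_ge) auto
  next
    fix d assume "d \<in> darts E"
    then obtain i where i: "i < n" "d = ds ! i"
      using assms(4) by (metis in_set_conv_nth n_def)
    have "(\<Sum>g\<in>darts E. transition_entry x d g * f g)
        = (\<Sum>j<n. transition_entry x d (ds ! j) * f (ds ! j))"
      by (rule sum.reindex_bij_betw[OF bij, symmetric])
    also have "\<dots> = (A *\<^sub>v v) $ i"
      using i v(1) by (simp add: A_def transition_matrix_def scalar_prod_def n_def f_nth[unfolded n_def]
          atLeast0LessThan)
    also have "\<dots> = k * f d" using i v(1) by (simp add: Av f_nth)
    finally show "(\<Sum>g\<in>darts E. transition_entry x d g * f g) = k * f d" .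
  next
    obtain i where "i < n" "v $ i \<noteq> 0" using v by (metis eq_vecI index_zero_vec carrier_vecD)
    then show "\<exists>d\<in>darts E. f d \<noteq> 0" using f_nth assms(4) n_def by (metis nth_mem)
  qed
  then show ?thesis using rho n A by (simp add: spec_rad_def A_def[symmetric])
qed

end
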